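(* Let $n\ge 2$, let $M\in\mathbb{R}^{n\times n}$ be a semimagic square matrix, and let $$M=\mathcal{X}_n\begin{pmatrix}\tilde Y & \tilde V^T\\ \tilde W & Z\end{pmatrix}\mathcal{X}_n$$ be its block representation. Then the dihedral equivalence class of $M$ is $$\left\{\mathcal{X}_n\begin{pmatrix}\tilde Y & s\tilde V^T\\ t\tilde W & stZ\end{pmatrix}\mathcal{X}_n,\ \ \mathcal{X}_n\begin{pmatrix}\tilde Y^T & s\tilde W^T\\ t\tilde V & stZ^T\end{pmatrix}\mathcal{X}_n\ \middle|\ s,t\in\{1,-1\}\right\}.$$
   Context: An $n\times n$ real matrix is a semimagic square (of weight $w\in\mathbb{R}$) if each of its rows and columns sums to $nw$. $\mathcal{I}_k$ is the $k\times k$ unit matrix, $0_k$ the null column vector in $\mathbb{R}^k$, and $\mathcal{J}_k=(\delta_{i,k+1-j})_{i,j=1}^k$ the matrix with ones on the antidiagonal and zeros elsewhere. For $k\in\mathbb{N}$, $$\mathcal{X}_{2k}=\frac1{\sqrt2}\begin{pmatrix}\mathcal{I}_k & \mathcal{J}_k\\ \mathcal{J}_k & -\mathcal{I}_k\end{pmatrix},\qquad \mathcal{X}_{2k+1}=\begin{pmatrix}\frac1{\sqrt2}\mathcal{I}_k & 0_k & \frac1{\sqrt2}\mathcal{J}_k\\ 0_k^T & 1 & 0_k^T\\ \frac1{\sqrt2}\mathcal{J}_k & 0_k & -\frac1{\sqrt2}\mathcal{I}_k\end{pmatrix};$$ these are symmetric involutions. The block representation of $M$ is the matrix $\mathcal{X}_nM\mathcal{X}_n$,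 partitioned so that $Z$ is $k\times k$, where $n=2k$ or $n=2k+1$; thus $\tilde Y$ is $k\times k$ if $n=2k$ and $(k+1)\times(k+1)$ if $n=2k+1$, and $\tilde V,\tilde W$ are $k\times k$ if $n=2k$ and $k\times(k+1)$ if $n=2k+1$. The dihedral equivalence class of $M$ is the set of all matrices obtained from $M$ by applying the rotations and reflections of the square (the dihedral group of the square) to the $n\times n$ array of its entries; this group is generated by transposition $M\mapsto M^T$ and reflection along the horizontal centreline $M\mapsto\mathcal{J}_nM$. *)

theory Defs
  imports Complex_Main "Jordan_Normal_Form.Matrix"
begin

definition semimagic_square :: "nat \<Rightarrow> real \<Rightarrow> real mat \<Rightarrow> bool" where
  "semimagic_square n w M \<longleftrightarrow>
     M \<in> carrier_mat n n \<and>
     (\<forall>i<n. (\<Sum>j<n. M $$ (i, j)) = real n * w) \<and>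
     (\<forall>j<n. (\<Sum>i<n. M $$ (i, j)) = real n * w)"

(* Indices start at 0, so the antidiagonal is i + j = k - 1. *)
definition antidiag_mat :: "nat \<Rightarrow> real mat" where
  "antidiag_mat k = mat k k (\<lambda>(i, j). if i + j + 1 = k then 1 else 0)"

definition X_even :: "nat \<Rightarrow> real mat" where
  "X_even k = (1 / sqrt 2) \<cdot>\<^sub>m
     four_block_mat (1\<^sub>m k) (antidiag_mat k)
                    (antidiag_mat k) (- 1\<^sub>m k)"

(* The 3 x 3 block matrix, grouped so that the upper left block comprises
   the first k + 1 rows and columns. The blocks with 0 rows only serve to put
   two matrices side by side. *)
definition X_odd :: "nat \<Rightarrow> real mat" where
  "X_odd k =
     four_block_mat
       (four_block_mat ((1 / sqrt 2) \<cdot>\<^sub>m 1\<^sub>m k) (0\<^sub>m k 1)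
                       (0\<^sub>m 1 k) (1\<^sub>m 1))
       (((1 / sqrt 2) \<cdot>\<^sub>m antidiag_mat k) @\<^sub>r 0\<^sub>m 1 k)
       (four_block_mat ((1 / sqrt 2) \<cdot>\<^sub>m antidiag_mat k) (0\<^sub>m k 1)
                       (0\<^sub>m 0 k) (0\<^sub>m 0 1))
       (- ((1 / sqrt 2) \<cdot>\<^sub>m 1\<^sub>m k))"

definition X_mat :: "nat \<Rightarrow> real mat" where
  "X_mat n = (if even n then X_even (n div 2) else X_odd (n div 2))"

(* The action of the symmetry group of the square on n x n arrays. It is generated
   by transposition and reflection along the horizontal centreline. Both
   are involutions on n x n matrices, so closure under inverses is automatic. *)
inductive_set dihedral_group :: "nat \<Rightarrow> (real mat \<Rightarrow> real mat) set" for n :: nat where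
  identity: "(\<lambda>A. A) \<in> dihedral_group n"
| transposition: "g \<in> dihedral_group n \<Longrightarrow> (\<lambda>A. transpose_mat (g A)) \<in> dihedral_group n"
| reflection: "g \<in> dihedral_group n \<Longrightarrow> (\<lambda>A. antidiag_mat n * g A) \<in> dihedral_group n"

definition dihedral_class :: "nat \<Rightarrow> real mat \<Rightarrow> real mat set" where
  "dihedral_class n M = {g M | g. g \<in> dihedral_group n}"

end

theory Submission
  imports Defs
begin

text \<open>Write \<open>X\<close> for \<^const>\<open>X_mat\<close>, \<open>J\<close> for the reflection matrix, and \<open>n = 2 k\<close> or
  \<open>n = 2 k + 1\<close>. The first \<open>n - k\<close> columns of \<open>X\<close> are symmetric vectors (unchanged when read
  backwards) and the remaining \<open>k\<close> columns are antisymmetric. In other words, the columns of \<open>X\<close> are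
  eigenvectors of \<open>J\<close>, and \<open>J X = X D\<close> with the diagonal matrix \<open>D\<close> having \<open>n - k\<close> entries \<open>1\<close>
  followed by \<open>k\<close> entries \<open>-1\<close> (\<open>antidiag_mult_X_mat\<close>). Hence \<open>J (X B X) = X (D B) X\<close>: the
  reflection of a matrix flips the sign of the lower blocks of its block representation. Since \<open>X\<close>
  is symmetric, transposing a matrix transposes its block representation.

  In terms of the family \<open>N\<^sub>s\<^sub>t\<close> of matrices with blocks \<open>Y, s V\<^sup>T, t W, s t Z\<close>, reflection thus maps
  \<open>N\<^sub>s\<^sub>t\<close> to \<open>N\<^sub>s\<^sub>,\<^sub>-\<^sub>t\<close>, and transposition maps it to \<open>N'\<^sub>t\<^sub>s\<close>, where \<open>N'\<close> is the family with
  \<open>Y\<^sup>T, W, V, Z\<^sup>T\<close> in place of \<open>Y, V, W, Z\<close>. The eight matrices of the two families are therefore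
  permuted by both generators of the group, and the two moves connect all of them to
  \<open>M = N\<^sub>1\<^sub>1\<close>.\<close>

section \<open>Entries and symmetry of the block transformation\<close>

lemma antidiag_mat_carrier [simp]: "antidiag_mat n \<in> carrier_mat n n"
  by (simp add: antidiag_mat_def)

lemma X_even_carrier: "X_even k \<in> carrier_mat (2 * k) (2 * k)"
  unfolding X_even_def antidiag_mat_def by (rule carrier_matI) auto

lemma X_odd_carrier: "X_odd k \<in> carrier_mat (2 * k + 1) (2 * k + 1)"
  unfolding X_odd_def antidiag_mat_def append_rows_def by (rule carrier_matI) auto

lemma X_mat_carrier:
  assumes n: "n = 2 * k \<or> n = 2 * k + 1"
  shows "X_mat n \<in> carrier_mat n n"
  using n X_even_carrier[of k] X_odd_carrier[of k] by (auto simp: X_mat_def)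

text \<open>A single formula for both parities. The first case is the centre of the array,
  which exists for odd \<open>n\<close> only.\<close>

lemma index_X_mat:
  assumes n: "n = 2 * k \<or> n = 2 * k + 1" and i: "i < n" and j: "j < n"
  shows "X_mat n $$ (i, j) =
      (if i = j \<and> i + j + 1 = n then 1
       else 1 / sqrt 2 * (if i = j then (if i < k then 1 else -1)
                          else if i + j + 1 = n then 1 else 0))"
  using n
proof
  assume n: "n = 2 * k"
  have X: "X_mat (2 * k) = X_even k"
    by (simp add: X_mat_def)
  have "l < k \<or> (\<exists>a. a < k \<and> l = k + a)" if "l < n" for l
    using that n by (cases "l < k") (auto intro!: exI[of _ "l - k"])
  note this[OF i] this[OF j]
  then show ?thesis
    by (elim disjE exE conjE) (simp_all add: X X_even_def antidiag_mat_def n)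
next
  assume n: "n = 2 * k + 1"
  have X: "X_mat (Suc (2 * k)) = X_odd k"
    by (simp add: X_mat_def)
  have "l < k \<or> l = k \<or> (\<exists>a. a < k \<and> l = Suc (k + a))" if "l < n" for l
    using that n by (cases "l \<le> k") (auto intro!: exI[of _ "l - Suc k"])
  note this[OF i] this[OF j]
  then show ?thesis
    by (elim disjE exE conjE)
       (simp_all add: X X_odd_def append_rows_def antidiag_mat_def n)
qed

lemma transpose_X_mat:
  assumes n: "n = 2 * k \<or> n = 2 * k + 1"
  shows "transpose_mat (X_mat n) = X_mat n"
  using X_mat_carrier[OF n] by (intro eq_matI) (auto simp: index_X_mat[OF n] add.commute)

section \<open>Reflecting the block transformation\<close>

lemma index_antidiag_mat_mult:
  assumes A: "A \<in> carrier_mat n m" and i: "i < n" and j: "j < m"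
  shows "(antidiag_mat n * A) $$ (i, j) = A $$ (n - 1 - i, j)"
proof -
  have "(antidiag_mat n * A) $$ (i, j) =
      (\<Sum>l = 0..<n. (if i + l + 1 = n then 1 else 0) * A $$ (l, j))"
    using assms by (auto simp: antidiag_mat_def scalar_prod_def intro!: sum.cong)
  also have "\<dots> = (\<Sum>l = 0..<n. if l = n - 1 - i then A $$ (l, j) else 0)"
    using i by (intro sum.cong) auto
  also have "\<dots> = A $$ (n - 1 - i, j)"
    using i by simp
  finally show ?thesis .
qed

text \<open>The sign matrix \<open>D\<close>: the eigenvalues of the reflection on the columns of
  \<^const>\<open>X_mat\<close>.\<close>

definition sign_mat :: "nat \<Rightarrow> nat \<Rightarrow> real mat" where
  "sign_mat m k = four_block_mat (1\<^sub>m m) (0\<^sub>m m k) (0\<^sub>m k m) (- 1\<^sub>m k)"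

lemma sign_mat_carrier: "sign_mat m k \<in> carrier_mat (m + k) (m + k)"
  by (simp add: sign_mat_def)

lemma index_mult_sign_mat:
  assumes A: "A \<in> carrier_mat r (m + k)" and i: "i < r" and j: "j < m + k"
  shows "(A * sign_mat m k) $$ (i, j) = (if j < m then A $$ (i, j) else - A $$ (i, j))"
proof -
  have "(A * sign_mat m k) $$ (i, j) =
      (\<Sum>l = 0..<m + k. A $$ (i, l) * (if l = j then (if j < m then 1 else -1) else 0))"
    using assms by (auto simp: sign_mat_def scalar_prod_def intro!: sum.cong)
  also have "\<dots> = (\<Sum>l = 0..<m + k. if l = j then (if j < m then A $$ (i, j) else - A $$ (i, j)) else 0)"
    by (intro sum.cong) auto
  also have "\<dots> = (if j < m then A $$ (i, j) else - A $$ (i, j))"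
    using j by simp
  finally show ?thesis .
qed

lemma sign_mat_mult_four_block:
  assumes "A \<in> carrier_mat m m" "B \<in> carrier_mat m k" "C \<in> carrier_mat k m" "E \<in> carrier_mat k k"
  shows "sign_mat m k * four_block_mat A B C E = four_block_mat A B (- C) (- E)"
  using assms unfolding sign_mat_def
  by (subst mult_four_block_mat[of _ m m _ k _ k _ _ m _ k]) auto

text \<open>Reading column \<open>j\<close> of \<^const>\<open>X_mat\<close> backwards exchanges its entry on the diagonal with the
  one on the antidiagonal. These agree for \<open>j < n - k\<close> and are opposite otherwise.\<close>

lemma antidiag_mult_X_mat:
  assumes n: "n = 2 * k \<or> n = 2 * k + 1"
  shows "antidiag_mat n * X_mat n = X_mat n * sign_mat (n - k) k"
proof -
  have nk: "n - k + k = n" using n by auto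
  note X = X_mat_carrier[OF n]
  show ?thesis
  proof (rule eq_matI)
    fix i j
    assume "i < dim_row (X_mat n * sign_mat (n - k) k)"
      and "j < dim_col (X_mat n * sign_mat (n - k) k)"
    then have ij: "i < n" "j < n"
      using X sign_mat_carrier[of "n - k" k] nk by auto
    have "(antidiag_mat n * X_mat n) $$ (i, j) = X_mat n $$ (n - 1 - i, j)"
      using index_antidiag_mat_mult[OF X ij] .
    also have "\<dots> = (if j < n - k then X_mat n $$ (i, j) else - X_mat n $$ (i, j))"
    proof -
      define l where "l = n - 1 - i"
      have l: "i + l + 1 = n" "l < n"
        using ij by (auto simp: l_def)
      have anti: "i + j + 1 = n \<longleftrightarrow> j = l" "l + j + 1 = n \<longleftrightarrow> j = i"
        using l(1) by auto
      \<comment> \<open>Column \<open>j\<close> is symmetric if it belongs to the left half or is the central one.\<close>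
      have left: "j < n - k \<longleftrightarrow> j < k \<or> j = l \<and> j = i" if j: "j = i \<or> j = l"
      proof (rule disjE[OF n])
        assume n: "n = 2 * k"
        then have "n - k = k" by simp
        moreover have "i \<noteq> l" using n l(1) by presburger
        ultimately show ?thesis by auto
      next
        assume n: "n = 2 * k + 1"
        then have "n - k = k + 1" by simp
        moreover have "i + l = 2 * k" using n l(1) by simp
        ultimately show ?thesis using j by auto
      qed
      have off: "(i < k) \<noteq> (l < k)" if "i \<noteq> l"
        using that n l(1) by auto
      show ?thesis
        unfolding l_def[symmetric] index_X_mat[OF n l(2) ij(2)] index_X_mat[OF n ij] anti
        using left off by (cases "j = i"; cases "j = l") auto
    qed
    also have "\<dots> = (X_mat n * sign_mat (n - k) k) $$ (i, j)"
      using index_mult_sign_mat[of "X_mat n" n "n - k" k i j] X ij nk by simp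
    finally show "(antidiag_mat n * X_mat n) $$ (i, j) = (X_mat n * sign_mat (n - k) k) $$ (i, j)" .
  qed (use X sign_mat_carrier[of "n - k" k] nk carrier_matD[OF antidiag_mat_carrier[of n]] in auto)
qed

section \<open>Transposition and reflection of block representations\<close>

definition signed_blocks ::
    "nat \<Rightarrow> real mat \<Rightarrow> real mat \<Rightarrow> real mat \<Rightarrow> real mat \<Rightarrow> real \<Rightarrow> real \<Rightarrow> real mat" where
  "signed_blocks n Y V W Z s t =
     X_mat n * four_block_mat Y (s \<cdot>\<^sub>m transpose_mat V) (t \<cdot>\<^sub>m W) ((s * t) \<cdot>\<^sub>m Z) * X_mat n"

lemma transpose_smult_mat: "transpose_mat (a \<cdot>\<^sub>m A) = a \<cdot>\<^sub>m transpose_mat A"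
  by (rule eq_matI) auto

lemma uminus_smult_mat: "- (a \<cdot>\<^sub>m A) = (- a) \<cdot>\<^sub>m (A :: real mat)"
  by (rule eq_matI) auto

context
  fixes n k :: nat and Y V W Z :: "real mat"
  assumes n: "n = 2 * k \<or> n = 2 * k + 1"
    and Y: "Y \<in> carrier_mat (n - k) (n - k)"
    and V: "V \<in> carrier_mat k (n - k)"
    and W: "W \<in> carrier_mat k (n - k)"
    and Z: "Z \<in> carrier_mat k k"
begin

lemma signed_blocks_inner_carrier:
  "four_block_mat Y (s \<cdot>\<^sub>m transpose_mat V) (t \<cdot>\<^sub>m W) ((s * t) \<cdot>\<^sub>m Z) \<in> carrier_mat n n"
proof -
  have "n - k + k = n" using n by auto
  then show ?thesis
    using four_block_carrier_mat[OF Y smult_carrier_mat[OF Z]] by simp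
qed

lemma antidiag_mult_signed_blocks:
  "antidiag_mat n * signed_blocks n Y V W Z s t = signed_blocks n Y V W Z s (- t)"
proof -
  let ?B = "four_block_mat Y (s \<cdot>\<^sub>m transpose_mat V) (t \<cdot>\<^sub>m W) ((s * t) \<cdot>\<^sub>m Z)"
  let ?D = "sign_mat (n - k) k"
  note X = X_mat_carrier[OF n] and B = signed_blocks_inner_carrier[of s t]
  have D: "?D \<in> carrier_mat n n"
  proof -
    have "n - k + k = n" using n by auto
    then show ?thesis using sign_mat_carrier[of "n - k" k] by simp
  qed
  have "antidiag_mat n * (X_mat n * ?B * X_mat n) = (antidiag_mat n * X_mat n) * ?B * X_mat n"
    using X B by (simp add: assoc_mult_mat[of _ n n _ n _ n])
  also have "\<dots> = X_mat n * (?D * ?B) * X_mat n"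
    using X B D by (simp add: antidiag_mult_X_mat[OF n] assoc_mult_mat[of _ n n _ n _ n])
  also have "?D * ?B = four_block_mat Y (s \<cdot>\<^sub>m transpose_mat V) (- (t \<cdot>\<^sub>m W)) (- ((s * t) \<cdot>\<^sub>m Z))"
    using Y V W Z by (intro sign_mat_mult_four_block) auto
  finally show ?thesis
    by (simp add: signed_blocks_def uminus_smult_mat)
qed

lemma transpose_signed_blocks:
  "transpose_mat (signed_blocks n Y V W Z s t) =
     signed_blocks n (transpose_mat Y) W V (transpose_mat Z) t s"
proof -
  let ?B = "four_block_mat Y (s \<cdot>\<^sub>m transpose_mat V) (t \<cdot>\<^sub>m W) ((s * t) \<cdot>\<^sub>m Z)"
  note X = X_mat_carrier[OF n] and B = signed_blocks_inner_carrier[of s t]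
  have "transpose_mat (X_mat n * ?B * X_mat n) = X_mat n * (transpose_mat ?B * X_mat n)"
    using X B by (simp add: transpose_mult[of _ n n _ n] transpose_X_mat[OF n])
  also have "\<dots> = X_mat n * transpose_mat ?B * X_mat n"
    using X B by (simp add: assoc_mult_mat[of _ n n _ n _ n])
  also have "transpose_mat ?B =
      four_block_mat (transpose_mat Y) (t \<cdot>\<^sub>m transpose_mat W) (s \<cdot>\<^sub>m V) ((t * s) \<cdot>\<^sub>m transpose_mat Z)"
    using Y V W Z
    by (subst transpose_four_block_mat[of _ "n - k" "n - k" _ k _ k])
       (auto simp: transpose_smult_mat mult.commute)
  finally show ?thesis
    by (simp add: signed_blocks_def)
qed

end

section \<open>Dihedral classes as closures\<close>

lemma dihedral_class_self: "M \<in> dihedral_class n M"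
  unfolding dihedral_class_def using dihedral_group.identity by force

lemma dihedral_class_transpose:
  "A \<in> dihedral_class n M \<Longrightarrow> transpose_mat A \<in> dihedral_class n M"
  unfolding dihedral_class_def using dihedral_group.transposition by force

lemma dihedral_class_reflect:
  "A \<in> dihedral_class n M \<Longrightarrow> antidiag_mat n * A \<in> dihedral_class n M"
  unfolding dihedral_class_def using dihedral_group.reflection by force

lemma dihedral_class_least:
  assumes "M \<in> S"
    and "\<And>A. A \<in> S \<Longrightarrow> transpose_mat A \<in> S"
    and "\<And>A. A \<in> S \<Longrightarrow> antidiag_mat n * A \<in> S"
  shows "dihedral_class n M \<subseteq> S"
proof -
  have "g M \<in> S" if "g \<in> dihedral_group n" for g
    using that by induction (use assms in auto)
  then show ?thesis by (auto simp: dihedral_class_def)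
qed

theorem theorem3:
  fixes n k :: nat and w :: real and M Y V W Z :: "real mat"
  assumes "n \<ge> 2"
    and "n = 2 * k \<or> n = 2 * k + 1"
    and "semimagic_square n w M"
    and "Y \<in> carrier_mat (n - k) (n - k)"
    and "V \<in> carrier_mat k (n - k)"
    and "W \<in> carrier_mat k (n - k)"
    and "Z \<in> carrier_mat k k"
    and "M = X_mat n * four_block_mat Y (transpose_mat V) W Z * X_mat n"
  shows "dihedral_class n M =
      {X_mat n * four_block_mat Y (s \<cdot>\<^sub>m transpose_mat V) (t \<cdot>\<^sub>m W) ((s * t) \<cdot>\<^sub>m Z) * X_mat n
        | s t. s \<in> {1, -1} \<and> t \<in> {1, -1}}
    \<union> {X_mat n * four_block_mat (transpose_mat Y) (s \<cdot>\<^sub>m transpose_mat W) (t \<cdot>\<^sub>m V)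
          ((s * t) \<cdot>\<^sub>m transpose_mat Z) * X_mat n
        | s t. s \<in> {1, -1} \<and> t \<in> {1, -1}}"
proof -
  let ?N = "signed_blocks n Y V W Z"
  let ?N' = "signed_blocks n (transpose_mat Y) W V (transpose_mat Z)"
  let ?S = "{?N s t | s t. s \<in> {1, -1} \<and> t \<in> {1, -1}} \<union> {?N' s t | s t. s \<in> {1, -1} \<and> t \<in> {1, -1}}"
  let ?C = "dihedral_class n M"
  have Yt: "transpose_mat Y \<in> carrier_mat (n - k) (n - k)" and Zt: "transpose_mat Z \<in> carrier_mat k k"
    using assms by auto
  note refl = antidiag_mult_signed_blocks[OF assms(2,4-7)]
  note refl' = antidiag_mult_signed_blocks[OF assms(2) Yt assms(6,5) Zt]
  note trans = transpose_signed_blocks[OF assms(2,4-7)]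
  have trans': "transpose_mat (?N' s t) = ?N t s" for s t
    using transpose_signed_blocks[OF assms(2) Yt assms(6,5) Zt] by simp
  have one: "1 \<cdot>\<^sub>m A = A" for A :: "real mat"
    by (rule eq_matI) auto
  have M: "M = ?N 1 1"
    using assms(8) by (simp add: signed_blocks_def one)
  have "?C \<subseteq> ?S"
  proof (rule dihedral_class_least)
    show "M \<in> ?S" using M by blast
  next
    fix A assume "A \<in> ?S"
    then consider s t where "s \<in> {1, -1}" "t \<in> {1, -1}" "A = ?N s t"
      | s t where "s \<in> {1, -1}" "t \<in> {1, -1}" "A = ?N' s t"
      by blast
    note cases = this
    show "transpose_mat A \<in> ?S"
      using cases by cases (use trans trans' in blast)+
    have neg: "- t \<in> {1, -1}" if "t \<in> {1, -1}" for t :: real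
      using that by auto
    show "antidiag_mat n * A \<in> ?S"
      using cases by cases (use refl refl' neg in blast)+
  qed
  moreover have "?S \<subseteq> ?C"
  proof -
    \<comment> \<open>Reflection alone only changes \<open>t\<close>; the sign \<open>s\<close> is changed by reflecting the transpose.\<close>
    have flip: "?N s (- t) \<in> ?C" and swap: "?N' t s \<in> ?C" if "?N s t \<in> ?C" for s t
      using dihedral_class_reflect[OF that] dihedral_class_transpose[OF that]
      by (simp_all add: refl trans)
    have flip': "?N' s (- t) \<in> ?C" and swap': "?N t s \<in> ?C" if "?N' s t \<in> ?C" for s t
      using dihedral_class_reflect[OF that] dihedral_class_transpose[OF that]
      by (simp_all add: refl' trans')
    have "?N 1 1 \<in> ?C"
      using dihedral_class_self[of M n] M by simp
    then have s: "?N s 1 \<in> ?C" if "s \<in> {1, -1}" for s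
      using that swap'[OF flip'[OF swap]] by auto
    have N: "?N s t \<in> ?C" if "s \<in> {1, -1}" "t \<in> {1, -1}" for s t
      using s[OF that(1)] flip[OF s[OF that(1)]] that(2) by auto
    then have "?N' s t \<in> ?C" if "s \<in> {1, -1}" "t \<in> {1, -1}" for s t
      using swap that by blast
    with N show ?thesis by blast
  qed
  ultimately have "?C = ?S" by (rule subset_antisym)
  then show ?thesis
    unfolding signed_blocks_def .
qed

end
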